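(* For a generic matrix $A\in\mathbb{C}^{n\times n}$ there exist $2n$ Hankel matrices $H_1,\dots,H_{2n}\in\mathbb{C}^{n\times n}$ and $n$ permutation matrices $P'_1,\dots,P'_n\in\mathbb{C}^{n\times n}$ such that \[ A=\Pi H_1H_2P'_1H_3H_4P'_2\cdots H_{2n-1}H_{2n}P'_n, \] where $\Pi=[\pi_{ij}]\in\mathbb{C}^{n\times n}$ is the permutation matrix with $\pi_{ij}=1$ if $i+j=n+1$ and $\pi_{ij}=0$ otherwise. In particular $A$ is a product of $2n$ Hankel matrices and $n+1$ permutation matrices.
   Context: A matrix $(h_{ij})$ is Hankel if $h_{ij}$ depends only on $i+j$. "For a generic $A$" means that the Zariski closure of the set of matrices $A\in\mathbb{C}^{n\times n}$ for which the property fails is a proper closed subset of $\mathbb{C}^{n\times n}$. *)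

theory Defs
  imports Complex_Main "HOL.Hull" "HOL-Combinatorics.Permutations" "Jordan_Normal_Form.Matrix"
begin

text \<open>Matrix indices range over \<open>0, \<dots>, n - 1\<close>.\<close>

definition hankel_mat :: "nat \<Rightarrow> complex mat \<Rightarrow> bool" where
  "hankel_mat n H \<longleftrightarrow> H \<in> carrier_mat n n \<and>
     (\<forall>i<n. \<forall>j<n. \<forall>k<n. \<forall>l<n. i + j = k + l \<longrightarrow> H $$ (i, j) = H $$ (k, l))"

definition permutation_mat :: "nat \<Rightarrow> complex mat \<Rightarrow> bool" where
  "permutation_mat n P \<longleftrightarrow>
     (\<exists>p. p permutes {0..<n} \<and> P = mat n n (\<lambda>(i, j). if j = p i then 1 else 0))"

definition exchange_mat :: "nat \<Rightarrow> complex mat" where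
  "exchange_mat n = mat n n (\<lambda>(i, j). if (i + 1) + (j + 1) = n + 1 then 1 else 0)"

definition mat_prod :: "nat \<Rightarrow> complex mat list \<Rightarrow> complex mat" where
  "mat_prod n Ms = foldr (*) Ms (1\<^sub>m n)"

text \<open>Polynomials in the \<open>n\<^sup>2\<close> entries of a matrix are represented by the functions they induce;
  Zariski-closed sets are determined by these.\<close>

inductive_set mat_polys :: "nat \<Rightarrow> (complex mat \<Rightarrow> complex) set" for n :: nat where
  const: "(\<lambda>A. c) \<in> mat_polys n"
| entry: "i < n \<Longrightarrow> j < n \<Longrightarrow> (\<lambda>A. A $$ (i, j)) \<in> mat_polys n"
| add: "f \<in> mat_polys n \<Longrightarrow> g \<in> mat_polys n \<Longrightarrow> (\<lambda>A. f A + g A) \<in> mat_polys n"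
| mult: "f \<in> mat_polys n \<Longrightarrow> g \<in> mat_polys n \<Longrightarrow> (\<lambda>A. f A * g A) \<in> mat_polys n"

definition zariski_closed :: "nat \<Rightarrow> complex mat set \<Rightarrow> bool" where
  "zariski_closed n Z \<longleftrightarrow>
     (\<exists>F \<subseteq> mat_polys n. Z = {A \<in> carrier_mat n n. \<forall>f\<in>F. f A = 0})"

definition zariski_closure :: "nat \<Rightarrow> complex mat set \<Rightarrow> complex mat set" where
  "zariski_closure n S = zariski_closed n hull S"

definition for_generic_mat :: "nat \<Rightarrow> (complex mat \<Rightarrow> bool) \<Rightarrow> bool" where
  "for_generic_mat n Q \<longleftrightarrow>
     zariski_closure n {A \<in> carrier_mat n n. \<not> Q A} \<subset> carrier_mat n n"

end

theory Submission
  imports Defs "Jordan_Normal_Form.Determinant"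
begin

text \<open>
  Every companion matrix is a product of two Hankel matrices, and a generic matrix is a product of
  \<open>n\<close> companion matrices; the permutation matrices between the Hankel pairs can all be the identity.

  Multiplying a matrix from the left by a companion matrix drops its top row, moves the others
  up, and appends an arbitrary linear combination of the old rows at the bottom.  Starting from the
  identity, \<open>n\<close> such steps can therefore produce the rows of a given \<open>B\<close> one after the other:
  after \<open>k\<close> steps the matrix is \<open>window n B k\<close>, whose rows are the last \<open>n - k\<close> unit vectors followed
  by the first \<open>k\<close> rows of \<open>B\<close>.  The next row of \<open>B\<close> is certainly a linear combination of these rows
  when \<open>window n B k\<close> is invertible (\<open>window_step\<close>).

  A companion matrix with last row \<open>c\<close> advances solutions of the linear recurrence with coefficients
  \<open>c\<close> by one step, so it maps the Hankel matrix of a solution \<open>h\<close> to the Hankel matrix of the shifted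
  solution.  If \<open>h\<close> is the impulse response, the first of these is anti-triangular, and its
  inverse is again Hankel, with entries read off from \<open>c\<close> (\<open>companion_hankel_factorization\<close>).

  Both facts are applied to \<open>B = \<Pi> A\<close>.  The exceptional set lies in the zero set of the product of
  the polynomials \<open>det (window n (\<Pi> A) k)\<close>, \<open>k < n\<close>.  At \<open>A = \<Pi>\<close> all the
  windows are permutation matrices, so the product does not vanish there and its zero set is proper.
\<close>

section \<open>Polynomial functions and genericity\<close>

lemma mat_polys_sum:
  assumes "\<And>x. x \<in> S \<Longrightarrow> g x \<in> mat_polys n"
  shows "(\<lambda>A. \<Sum>x\<in>S. g x A) \<in> mat_polys n"
  using assms
  by (induction S rule: infinite_finite_induct) (auto intro: mat_polys.intros)

lemma mat_polys_prod:
  assumes "\<And>x. x \<in> S \<Longrightarrow> g x \<in> mat_polys n"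
  shows "(\<lambda>A. \<Prod>x\<in>S. g x A) \<in> mat_polys n"
  using assms
  by (induction S rule: infinite_finite_induct) (auto intro: mat_polys.intros)

lemma mat_polys_det:
  assumes "\<And>i j. i < m \<Longrightarrow> j < m \<Longrightarrow> g i j \<in> mat_polys n"
  shows "(\<lambda>A. det (mat m m (\<lambda>(i, j). g i j A))) \<in> mat_polys n"
proof -
  let ?s = "\<lambda>p A. \<Prod>i\<in>{0..<m}. g i (p i) A"
  have "(\<lambda>A. \<Sum>p | p permutes {0..<m}. signof p * ?s p A) \<in> mat_polys n"
    by (intro mat_polys_sum mat_polys.mult mat_polys.const mat_polys_prod assms)
      (auto simp: permutes_in_image)
  moreover have "det (mat m m (\<lambda>(i, j). g i j A)) =
      (\<Sum>p | p permutes {0..<m}. signof p * ?s p A)" for A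
    by (subst det_def'[of _ m])
      (auto intro!: sum.cong prod.cong arg_cong2[of _ _ _ _ "(*)"] simp: permutes_in_image)
  ultimately show ?thesis by simp
qed

lemma for_generic_matI:
  assumes "f \<in> mat_polys n"
    and "X \<in> carrier_mat n n" "f X \<noteq> 0"
    and "\<And>A. A \<in> carrier_mat n n \<Longrightarrow> f A \<noteq> 0 \<Longrightarrow> Q A"
  shows "for_generic_mat n Q"
proof -
  let ?Z = "{A \<in> carrier_mat n n. f A = 0}"
  have "zariski_closed n ?Z"
    unfolding zariski_closed_def using assms(1) by (intro exI[of _ "{f}"]) auto
  hence "zariski_closure n {A \<in> carrier_mat n n. \<not> Q A} \<subseteq> ?Z"
    unfolding zariski_closure_def using assms(4) by (intro hull_minimal) auto
  thus ?thesis
    unfolding for_generic_mat_def using assms(2,3) by auto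
qed

section \<open>Companion matrices as products of two Hankel matrices\<close>

definition companion :: "nat \<Rightarrow> complex mat \<Rightarrow> bool" where
  "companion n C \<longleftrightarrow> C \<in> carrier_mat n n \<and>
     (\<forall>i j. Suc i < n \<longrightarrow> j < n \<longrightarrow> C $$ (i, j) = (if j = Suc i then 1 else 0))"

text \<open>The impulse response: the solution of \<open>h (n + j) = (\<Sum>k<n. c k * h (j + k))\<close> with the initial
  values \<open>0, \<dots>, 0, 1\<close>.\<close>

function impulse :: "nat \<Rightarrow> (nat \<Rightarrow> complex) \<Rightarrow> nat \<Rightarrow> complex" where
  "impulse n c m = (if m < n then (if Suc m = n then 1 else 0)
     else (\<Sum>k<n. c k * impulse n c (m - n + k)))"
  by auto
termination by (relation "measure (\<lambda>(n, c, m). m)") auto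

declare impulse.simps [simp del]

lemma impulse_init: "m < n \<Longrightarrow> impulse n c m = (if Suc m = n then 1 else 0)"
  by (simp add: impulse.simps)

lemma impulse_rec: "impulse n c (n + j) = (\<Sum>k<n. c k * impulse n c (j + k))"
  by (subst impulse.simps) simp

text \<open>The generating function of the impulse response is the reciprocal of
  \<open>1 - c\<^sub>n\<^sub>-\<^sub>1 x - \<dots> - c\<^sub>0 x\<^sup>n\<close>, which is why its anti-triangular Hankel matrix has an inverse that is
  Hankel with the symbol \<open>g\<close> below.  That inverse and the shifted Hankel matrix of the impulse
  response multiply to the companion matrix.\<close>

lemma companion_hankel_factorization:
  assumes "companion n C"
  obtains L R where "hankel_mat n L" "hankel_mat n R" "C = L * R"
proof -
  define c where "c k = C $$ (n - 1, k)" for k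
  define h where "h = impulse n c"
  define g where "g m = (if Suc m < n then - c (Suc m) else if Suc m = n then 1 else 0)" for m
  define L where "L = mat n n (\<lambda>(i, j). h (Suc (i + j)))"
  define R where "R = mat n n (\<lambda>(i, j). g (i + j))"
  have h0: "h m = 0" if "Suc m < n" for m
    using that by (simp add: h_def impulse_init)
  have h1: "h m = 1" if "Suc m = n" for m
    using that by (simp add: h_def impulse_init)
  have hrec: "h (n + j) = (\<Sum>k<n. c k * h (j + k))" for j
    by (simp add: h_def impulse_rec)
  have C: "C $$ (i, k) = (if Suc i = n then c k else if k = Suc i then 1 else 0)"
    if "i < n" "k < n" for i k
    using assms that by (auto simp: companion_def c_def)
  have entry: "(\<Sum>j<n. h (Suc (i + j)) * g (j + k)) = C $$ (i, k)" if ik: "i < n" "k < n" for i k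
  proof -
    \<comment> \<open>Only the terms with \<open>j + k < n\<close> survive; the one with \<open>j + k = n - 1\<close> has coefficient \<open>1\<close>.\<close>
    obtain d where d: "n = Suc (k + d)"
      using ik less_imp_Suc_add by blast
    have "(\<Sum>j<n. h (Suc (i + j)) * g (j + k)) = (\<Sum>j<Suc d. h (Suc (i + j)) * g (j + k))"
      by (rule sum.mono_neutral_right) (auto simp: d g_def)
    also have "\<dots> = h (Suc (i + d)) - (\<Sum>j<d. c (Suc k + j) * h (Suc (i + j)))"
      by (auto simp: g_def d add.commute mult.commute simp flip: sum_negf intro!: sum.cong)
    also have "\<dots> = C $$ (i, k)"
    proof (cases "k \<le> i")
      case True
      then obtain e where e: "i = k + e" using le_Suc_ex by blast
      have "h (Suc (i + d)) = h (n + e)" by (simp add: d e algebra_simps)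
      also have "\<dots> = (\<Sum>m<Suc k + d. c m * h (e + m))"
        unfolding hrec by (simp add: d)
      also have "\<dots> = (\<Sum>m<Suc k. c m * h (e + m)) + (\<Sum>j<d. c (Suc k + j) * h (e + (Suc k + j)))"
        by (induction d) (simp_all add: add.assoc)
      also have "(\<Sum>j<d. c (Suc k + j) * h (e + (Suc k + j))) = (\<Sum>j<d. c (Suc k + j) * h (Suc (i + j)))"
        by (simp add: e algebra_simps)
      also have "(\<Sum>m<Suc k. c m * h (e + m)) = c k * h i"
      proof -
        have "(\<Sum>m<k. c m * h (e + m)) = 0"
          using ik by (intro sum.neutral) (auto simp: e intro!: h0)
        thus ?thesis by (simp add: e add.commute)
      qed
      finally show ?thesis
        using ik True by (auto simp: C h0 h1 e)
    next
      case False
      have "(\<Sum>j<d. c (Suc k + j) * h (Suc (i + j))) = 0"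
        using False by (intro sum.neutral) (auto simp: d intro!: h0)
      moreover have "h (Suc (i + d)) = (if k = Suc i then 1 else 0)"
        using False by (auto simp: d intro!: h0 h1)
      ultimately show ?thesis using ik False by (auto simp: C d)
    qed
    finally show ?thesis .
  qed
  show thesis
  proof
    show "hankel_mat n L" by (auto simp: hankel_mat_def L_def)
    show "hankel_mat n R" by (auto simp: hankel_mat_def R_def)
    show "C = L * R"
      using assms
      by (intro eq_matI)
        (auto simp: companion_def L_def R_def scalar_prod_def atLeast0LessThan entry)
  qed
qed

section \<open>Producing the rows of a matrix by companion steps\<close>

definition window :: "nat \<Rightarrow> complex mat \<Rightarrow> nat \<Rightarrow> complex mat" where
  "window n B k = mat n n (\<lambda>(i, j).
     if i + k < n then (if i + k = j then 1 else 0) else B $$ (i + k - n, j))"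

lemma window_carrier [simp]: "window n B k \<in> carrier_mat n n"
  by (simp add: window_def)

lemma window_0: "window n B 0 = 1\<^sub>m n"
  by (rule eq_matI) (auto simp: window_def)

lemma window_full: "B \<in> carrier_mat n n \<Longrightarrow> window n B n = B"
  by (rule eq_matI) (auto simp: window_def)

text \<open>The rows of a window, without the topmost one, are the upper rows of the next window.  Hence
  the quotient of consecutive windows has unit vectors as its rows, except for the last one.\<close>

lemma window_step:
  assumes "k < n" "det (window n B k) \<noteq> 0"
  obtains C where "companion n C" "C * window n B k = window n B (Suc k)"
proof -
  let ?W = "window n B"
  obtain V where V: "V \<in> carrier_mat n n" "V * ?W k = 1\<^sub>m n" "?W k * V = 1\<^sub>m n"
    using det_non_zero_imp_unit[OF window_carrier assms(2), of "undefined"]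
    unfolding Units_def ring_mat_def by auto
  define C where "C = ?W (Suc k) * V"
  have C: "C \<in> carrier_mat n n" unfolding C_def using V by (intro mult_carrier_mat) auto
  have "C $$ (i, j) = (if j = Suc i then 1 else 0)" if ij: "Suc i < n" "j < n" for i j
  proof -
    have "row (?W (Suc k)) i = row (?W k) (Suc i)"
      using ij by (intro eq_vecI) (auto simp: window_def)
    hence "C $$ (i, j) = (?W k * V) $$ (Suc i, j)"
      using ij V(1) by (simp add: C_def index_mult_mat carrier_matD[OF window_carrier])
    thus ?thesis using ij V(3) by auto
  qed
  moreover have "C * ?W k = ?W (Suc k)"
    unfolding C_def using V
    by (subst assoc_mult_mat[of _ n n _ n _ n]) (auto simp: right_mult_one_mat[OF window_carrier])
  ultimately show thesis using C that unfolding companion_def by blast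
qed

lemma mat_prod_Nil [simp]: "mat_prod n [] = 1\<^sub>m n"
  and mat_prod_Cons [simp]: "mat_prod n (X # Xs) = X * mat_prod n Xs"
  by (simp_all add: mat_prod_def)

lemma companion_steps_hankel:
  assumes B: "B \<in> carrier_mat n n"
    and det: "\<And>k. k < n \<Longrightarrow> det (window n B k) \<noteq> 0"
  obtains H where "\<And>k. 1 \<le> k \<Longrightarrow> k \<le> 2 * n \<Longrightarrow> hankel_mat n (H k)"
    "B = mat_prod n (concat (map (\<lambda>k. [H (2 * k - 1), H (2 * k), 1\<^sub>m n]) [1..<n + 1]))"
proof -
  \<comment> \<open>The first step of the construction is the rightmost factor.\<close>
  have "\<exists>L R. hankel_mat n L \<and> hankel_mat n R \<and>
      L * R * window n B (n - k) = window n B (Suc (n - k))" if "k \<in> {1..n}" for k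
  proof -
    have k: "n - k < n" using that by auto
    obtain C where C: "companion n C" "C * window n B (n - k) = window n B (Suc (n - k))"
      using window_step[OF k det[OF k]] .
    obtain L R where "hankel_mat n L" "hankel_mat n R" "C = L * R"
      using companion_hankel_factorization[OF C(1)] .
    with C(2) show ?thesis by blast
  qed
  then obtain L R where LR: "\<And>k. k \<in> {1..n} \<Longrightarrow> hankel_mat n (L k)"
      "\<And>k. k \<in> {1..n} \<Longrightarrow> hankel_mat n (R k)"
      "\<And>k. k \<in> {1..n} \<Longrightarrow> L k * R k * window n B (n - k) = window n B (Suc (n - k))"
    by metis
  define H where "H j = (if odd j then L (Suc j div 2) else R (j div 2))" for j
  have H: "H (2 * k - 1) = L k" "H (2 * k) = R k" if "1 \<le> k" for k
    using that by (auto simp: H_def Suc_diff_le)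
  have "mat_prod n (concat (map (\<lambda>k. [H (2 * k - 1), H (2 * k), 1\<^sub>m n]) [Suc (n - m)..<Suc n])) =
      window n B m" if "m \<le> n" for m
    using that
  proof (induction m)
    case 0
    show ?case by (simp add: window_0)
  next
    case (Suc m)
    define k where "k = n - m"
    have k: "k \<in> {1..n}" "Suc (n - Suc m) = k" "n - k = m"
      using Suc.prems by (auto simp: k_def)
    have car: "L k \<in> carrier_mat n n" "R k \<in> carrier_mat n n"
      using LR(1,2)[OF k(1)] by (auto simp: hankel_mat_def)
    have "[k..<Suc n] = k # [Suc k..<Suc n]" using k(1) by (simp add: upt_conv_Cons)
    hence "mat_prod n (concat (map (\<lambda>k. [H (2 * k - 1), H (2 * k), 1\<^sub>m n]) [k..<Suc n])) =
        L k * (R k * (1\<^sub>m n * window n B m))"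
      using Suc.IH Suc.prems H[of k] k(1) by (simp add: k_def del: upt_Suc)
    also have "\<dots> = L k * R k * window n B m"
      using car by (simp add: left_mult_one_mat[OF window_carrier]
          assoc_mult_mat[OF car window_carrier])
    also have "\<dots> = window n B (Suc m)" using LR(3)[OF k(1)] k(3) by simp
    finally show ?case unfolding k(2) .
  qed
  from this[of n] have "B = mat_prod n (concat (map (\<lambda>k. [H (2 * k - 1), H (2 * k), 1\<^sub>m n]) [1..<n + 1]))"
    by (simp add: window_full[OF B] del: upt_Suc)
  moreover have "hankel_mat n (H j)" if "1 \<le> j" "j \<le> 2 * n" for j
    using that by (cases "odd j") (auto simp: H_def elim!: oddE evenE intro!: LR)
  ultimately show thesis using that by blast
qed

section \<open>Permutation matrices\<close>

lemma permutation_mat_one: "permutation_mat n (1\<^sub>m n)"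
  unfolding permutation_mat_def
  by (intro exI[of _ id] conjI permutes_id eq_matI) auto

lemma exchange_mat_carrier [simp]: "exchange_mat n \<in> carrier_mat n n"
  by (simp add: exchange_mat_def)

lemma permutation_mat_exchange: "permutation_mat n (exchange_mat n)"
proof -
  define p where "p i = (if i < n then n - 1 - i else i)" for i
  have "p permutes {0..<n}"
    by (rule bij_imp_permutes, rule bij_betw_byWitness[of _ p]) (auto simp: p_def)
  moreover have "exchange_mat n = mat n n (\<lambda>(i, j). if j = p i then 1 else 0)"
    unfolding exchange_mat_def by (rule cong_mat) (auto simp: p_def)
  ultimately show ?thesis unfolding permutation_mat_def by blast
qed

lemma exchange_mult_index:
  assumes "A \<in> carrier_mat n n" "i < n" "j < n"
  shows "(exchange_mat n * A) $$ (i, j) = A $$ (n - 1 - i, j)"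
proof -
  have "(exchange_mat n * A) $$ (i, j) =
      (\<Sum>l<n. (if l = n - 1 - i then 1 else 0) * A $$ (l, j))"
    using assms
    by (auto simp: exchange_mat_def scalar_prod_def atLeast0LessThan intro!: sum.cong)
  also have "\<dots> = (\<Sum>l<n. if l = n - 1 - i then A $$ (l, j) else 0)"
    by (intro sum.cong) auto
  also have "\<dots> = A $$ (n - 1 - i, j)" using assms by simp
  finally show ?thesis .
qed

lemma exchange_involution: "exchange_mat n * exchange_mat n = 1\<^sub>m n"
proof (rule eq_matI)
  fix i j assume "i < dim_row (1\<^sub>m n :: complex mat)" "j < dim_col (1\<^sub>m n :: complex mat)"
  thus "(exchange_mat n * exchange_mat n) $$ (i, j) = 1\<^sub>m n $$ (i, j)"
    by (subst exchange_mult_index) (auto simp: exchange_mat_def)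
qed (auto simp: exchange_mat_def)

text \<open>The windows of the identity are the cyclic permutation matrices, which are orthogonal.\<close>

lemma det_window_one:
  assumes "k < n"
  shows "det (window n (1\<^sub>m n) k) \<noteq> 0"
proof -
  let ?W = "window n (1\<^sub>m n) k"
  define p where "p i = (if i + k < n then i + k else i + k - n)" for i
  have W: "?W = mat n n (\<lambda>(i, j). if j = p i then 1 else 0)"
    unfolding window_def using assms by (intro cong_mat) (auto simp: p_def)
  have p: "p i < n" "p i = p j \<longleftrightarrow> i = j" if "i < n" "j < n" for i j
    using that assms by (auto simp: p_def split: if_splits)
  have "?W * transpose_mat ?W = 1\<^sub>m n"
  proof (rule eq_matI)
    fix i j assume "i < dim_row (1\<^sub>m n :: complex mat)" "j < dim_col (1\<^sub>m n :: complex mat)"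
    hence ij: "i < n" "j < n" by auto
    hence "(?W * transpose_mat ?W) $$ (i, j) =
        (\<Sum>l<n. (if l = p i then 1 else 0) * (if l = p j then 1 else 0))"
      by (simp add: W scalar_prod_def atLeast0LessThan)
    also have "\<dots> = (\<Sum>l<n. if l = p i then (if p i = p j then 1 else 0) else 0)"
      by (intro sum.cong) auto
    also have "\<dots> = 1\<^sub>m n $$ (i, j)" using ij p by simp
    finally show "(?W * transpose_mat ?W) $$ (i, j) = 1\<^sub>m n $$ (i, j)" .
  qed (auto simp: window_def)
  hence "det ?W * det (transpose_mat ?W) = 1"
    by (metis det_mult det_one transpose_carrier_mat window_carrier)
  thus ?thesis by auto
qed

section \<open>The generic factorization\<close>

lemma triples_in_shuffles:
  "concat (map (\<lambda>k. [a k, b k, p k]) ks) \<in> shuffles (concat (map (\<lambda>k. [a k, b k]) ks)) (map p ks)"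
  by (induction ks) (auto intro!: Cons_in_shuffles_leftI Cons_in_shuffles_rightI)

theorem mainTheorem11:
  fixes n :: nat
  assumes "n \<ge> 1"
  shows "for_generic_mat n (\<lambda>A.
    (\<exists>H P. (\<forall>k\<in>{1..2 * n}. hankel_mat n (H k)) \<and>
           (\<forall>k\<in>{1..n}. permutation_mat n (P k)) \<and>
           A = exchange_mat n *
               mat_prod n (concat (map (\<lambda>k. [H (2 * k - 1), H (2 * k), P k]) [1..<n + 1]))) \<and>
    (\<exists>Hs Ps Ms. length Hs = 2 * n \<and> (\<forall>H\<in>set Hs. hankel_mat n H) \<and>
           length Ps = n + 1 \<and> (\<forall>P\<in>set Ps. permutation_mat n P) \<and>
           Ms \<in> shuffles Hs Ps \<and> A = mat_prod n Ms))"
proof (rule for_generic_matI)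
  let ?E = "exchange_mat n"
  let ?f = "\<lambda>A. \<Prod>k<n. det (window n (?E * A) k)"
  \<comment> \<open>The entries of \<open>\<Pi> A\<close> are expressed by those of \<open>A\<close>: membership in \<open>mat_polys\<close> is an
    equality of functions on matrices of all sizes, where \<open>?f\<close> and \<open>?g\<close> may differ.\<close>
  let ?g = "\<lambda>A. \<Prod>k<n. det (mat n n (\<lambda>(i, j).
    (if i + k < n then (if i + k = j then 1 else 0) else A $$ (n - 1 - (i + k - n), j))))"
  have fg: "?g A = ?f A" if "A \<in> carrier_mat n n" for A
    unfolding window_def using that
    by (intro prod.cong arg_cong[of _ _ det] cong_mat) (auto simp: exchange_mult_index simp del: index_mult_mat)
  show "?g \<in> mat_polys n"
  proof (intro mat_polys_prod mat_polys_det)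
    fix k i j assume "i < n" "j < n" and "k \<in> {..<n}"
    thus "(\<lambda>A. if i + k < n then (if i + k = j then 1 else 0) else A $$ (n - 1 - (i + k - n), j))
        \<in> mat_polys n"
      by (cases "i + k < n") (auto intro: mat_polys.intros)
  qed
  show "?E \<in> carrier_mat n n" by simp
  show "?g ?E \<noteq> 0"
    unfolding fg[OF exchange_mat_carrier] exchange_involution by (simp add: det_window_one)
  fix A :: "complex mat" assume A: "A \<in> carrier_mat n n" and "?g A \<noteq> 0"
  hence det: "det (window n (?E * A) k) \<noteq> 0" if "k < n" for k
    using that fg[OF A] by simp
  have EA: "?E * A \<in> carrier_mat n n" using A by (intro mult_carrier_mat) auto
  obtain H where H: "\<And>k. 1 \<le> k \<Longrightarrow> k \<le> 2 * n \<Longrightarrow> hankel_mat n (H k)"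
    and EA_eq: "?E * A =
      mat_prod n (concat (map (\<lambda>k. [H (2 * k - 1), H (2 * k), 1\<^sub>m n]) [1..<n + 1]))"
    using companion_steps_hankel[OF EA det] by blast
  let ?Ts = "concat (map (\<lambda>k. [H (2 * k - 1), H (2 * k), 1\<^sub>m n]) [1..<n + 1])"
  have "A = (?E * ?E) * A" using A by (simp add: exchange_involution)
  also have "\<dots> = ?E * (?E * A)" using A by (intro assoc_mult_mat[of _ n n _ n _ n]) auto
  finally have A_eq: "A = ?E * mat_prod n ?Ts" unfolding EA_eq .
  let ?Hs = "concat (map (\<lambda>k. [H (2 * k - 1), H (2 * k)]) [1..<n + 1])"
  let ?Ps = "?E # map (\<lambda>k. 1\<^sub>m n) [1..<n + 1]"
  have "length ?Hs = 2 * n"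
    by (simp add: length_concat sum_list_triv comp_def del: upt_Suc)
  moreover have "\<forall>X\<in>set ?Hs. hankel_mat n X" by (auto intro!: H)
  moreover have "length ?Ps = n + 1" by simp
  moreover have "\<forall>P\<in>set ?Ps. permutation_mat n P"
    by (auto simp: permutation_mat_exchange permutation_mat_one)
  moreover have "?E # ?Ts \<in> shuffles ?Hs ?Ps"
    by (intro Cons_in_shuffles_rightI triples_in_shuffles)
  moreover have "A = mat_prod n (?E # ?Ts)" using A_eq by simp
  ultimately have part2: "\<exists>Hs Ps Ms. length Hs = 2 * n \<and> (\<forall>H\<in>set Hs. hankel_mat n H) \<and>
           length Ps = n + 1 \<and> (\<forall>P\<in>set Ps. permutation_mat n P) \<and>
           Ms \<in> shuffles Hs Ps \<and> A = mat_prod n Ms" by blast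
  show "(\<exists>H P. (\<forall>k\<in>{1..2 * n}. hankel_mat n (H k)) \<and>
           (\<forall>k\<in>{1..n}. permutation_mat n (P k)) \<and>
           A = exchange_mat n *
               mat_prod n (concat (map (\<lambda>k. [H (2 * k - 1), H (2 * k), P k]) [1..<n + 1]))) \<and>
    (\<exists>Hs Ps Ms. length Hs = 2 * n \<and> (\<forall>H\<in>set Hs. hankel_mat n H) \<and>
           length Ps = n + 1 \<and> (\<forall>P\<in>set Ps. permutation_mat n P) \<and>
           Ms \<in> shuffles Hs Ps \<and> A = mat_prod n Ms)"
    using H A_eq part2
    by (intro conjI exI[of _ H] exI[of _ "\<lambda>_. 1\<^sub>m n"]) (auto simp: permutation_mat_one)
qed

end
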